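(* Consider the linear regression setting and the high-dimensional asymptotic assumptions described in the context, and suppose that each candidate model contains the true model, i.e. for every $i=1,\dots,m$ one has $\beta_k=0$ for all $k\notin S_i$. Define the signal-to-noise ratio $\mathrm{SNR}=r^2/\sigma^2$ and let $\hat\Gamma$ be a consistent estimator of $\mathrm{SNR}$. Let $\hat H=(\hat h_{ij})_{1\le i,j\le m}$ be defined by $$\hat h_{ii}=\begin{cases}\dfrac{\gamma_i}{\eta_i-\gamma_i} & \gamma_i<\eta_i,\\[2mm] \left(1-\dfrac{\eta_i}{\gamma_i}\right)\hat\Gamma+\dfrac{\eta_i}{\gamma_i-\eta_i} & \eta_i<\gamma_i,\end{cases}$$ and, for $i\ne j$, $$\hat h_{ij}=\begin{cases}\dfrac{\eta_{ij}\gamma_{ij}}{\eta_i\eta_j-\eta_{ij}\gamma_{ij}} & \gamma_i<\eta_i,\ \gamma_j<\eta_j,\\[2mm] \dfrac{\eta_{ij}\gamma_{ij}}{\eta_i\gamma_j-\eta_{ij}\gamma_{ij}} & \gamma_i<\eta_i,\ \eta_j<\gamma_j,\\[2mm] \dfrac{\eta_{ij}\gamma_{ij}}{\eta_j\gamma_i-\eta_{ij}\gamma_{ij}} & \gamma_j<\eta_j,\ \eta_i<\gamma_i,\\[2mm] \dfrac{(\gamma_i-\eta_i)(\gamma_j-\eta_j)}{\gamma_i\gamma_j-\eta_{ij}\gamma_{ij}}\hat\Gamma+\dfrac{\eta_{ij}\gamma_{ij}}{\gamma_i\gamma_j-\eta_{ij}\gamma_{ij}} & \eta_i<\gamma_i,\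 \eta_j<\gamma_j.\end{cases}$$ Then, with $\mathbf 1=(1,\dots,1)^\top\in\mathbb{R}^m$, $$w_{\mathrm{opt}}=\frac{1}{\mathbf 1^\top\hat H^{-1}\mathbf 1}\hat H^{-1}\mathbf 1\ \longrightarrow\ \operatorname*{argmin}_{w\in\mathbb{R}^m:\ \sum_i w_i=1} w^\top H w$$ in probability as $n\to\infty$, where $H$ is the positive definite matrix given in the context.
   Context: **Model.** For each $n$, $y=X\beta+\epsilon\in\mathbb{R}^n$, where $X=X_n\in\mathbb{R}^{n\times p}$ ($p=p_n$) and $\epsilon\in\mathbb{R}^n$ has i.i.d. entries with mean $0$ and variance $\sigma^2>0$, independent of $X$. **High-dimensional asymptotics.** (1) The entries of $X_n$ are i.i.d. with mean $0$, variance $1$ and $\mathbb{E}[|X_{n,ij}|^{12+\omega}]<\infty$ for some $\omega>0$. (2) $n,p\to\infty$ with $p/n\to\gamma>0$. (3) There is a fixed number $m$ of candidate models; model $i$ uses a nonrandom feature index set $S_i\subseteq\{1,\dots,p\}$, with $|S_i|\to\infty$, $|S_i\cap S_j|\to\infty$, $|S_i|/n\to\gamma_i>0$ and $|S_i\cap S_j|/n\to\gamma_{ij}>0$. (4) Model $i$ uses a nonrandom sample index set $T_i\subseteq\{1,\dots,n\}$, with $|T_i|\to\infty$, $|T_i|/n\to\eta_i>0$ and $|T_i\cap T_j|/n\to\eta_{ij}>0$. It is assumed that $\gamma_i\neq\eta_i$ for every $i$. **Coefficients.** $\beta=\beta_n\in\mathbb{R}^p$ is deterministic with $\|\beta\|^2=r^2$,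 $r>0$ fixed. **Consistency.** $\hat\Gamma$ consistent means $\hat\Gamma\to\mathrm{SNR}$ in probability as $n\to\infty$. **The matrix $H$** $=(h_{ij})$ (positive definite; $w^\top Hw$ is the limiting out-of-sample risk of the model averaging estimator with limiting weights $w$): $$h_{ii}=\begin{cases}\sigma^2\frac{\gamma_i}{\eta_i-\gamma_i} & \gamma_i<\eta_i,\\ \left(1-\frac{\eta_i}{\gamma_i}\right)r^2+\frac{\eta_i}{\gamma_i-\eta_i}\sigma^2 & \gamma_i>\eta_i,\end{cases}$$ and for $i\ne j$ $$h_{ij}=\begin{cases}\frac{\eta_{ij}\gamma_{ij}}{\eta_i\eta_j-\eta_{ij}\gamma_{ij}}\sigma^2 & \gamma_i<\eta_i,\ \gamma_j<\eta_j,\\ \frac{\eta_{ij}\gamma_{ij}}{\eta_i\gamma_j-\eta_{ij}\gamma_{ij}}\sigma^2 & \gamma_i<\eta_i,\ \eta_j<\gamma_j,\\ \frac{\eta_{ij}\gamma_{ij}}{\eta_j\gamma_i-\eta_{ij}\gamma_{ij}}\sigma^2 & \gamma_j<\eta_j,\ \eta_i<\gamma_i,\\ \frac{(\gamma_i-\eta_i)(\gamma_j-\eta_j)}{\gamma_i\gamma_j-\eta_{ij}\gamma_{ij}}r^2+\frac{\eta_{ij}\gamma_{ij}}{\gamma_i\gamma_j-\eta_{ij}\gamma_{ij}}\sigma^2 & \eta_i<\gamma_i,\ \eta_j<\gamma_j.\end{cases}$$ *)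

theory Defs
  imports "HOL-Probability.Probability"
begin

definition iid :: "'a measure \<Rightarrow> 'i set \<Rightarrow> ('i \<Rightarrow> 'a \<Rightarrow> real) \<Rightarrow> bool" where
  "iid M I Z \<longleftrightarrow>
     prob_space.indep_vars M (\<lambda>_. borel) Z I \<and>
     (\<forall>i\<in>I. \<forall>j\<in>I. distr M borel (Z i) = distr M borel (Z j))"

text \<open>
  \<^term>\<open>prob_space.indep_var\<close> forces both random elements to have the same type; this is its
  counterpart for random elements of different types.
\<close>
definition indep_elements ::
  "'a measure \<Rightarrow> 'b measure \<Rightarrow> ('a \<Rightarrow> 'b) \<Rightarrow> 'c measure \<Rightarrow> ('a \<Rightarrow> 'c) \<Rightarrow> bool" where
  "indep_elements M N\<^sub>1 Y N\<^sub>2 Z \<longleftrightarrow>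
     Y \<in> measurable M N\<^sub>1 \<and> Z \<in> measurable M N\<^sub>2 \<and>
     prob_space.indep_set M
       {Y -` A \<inter> space M | A. A \<in> sets N\<^sub>1} {Z -` B \<inter> space M | B. B \<in> sets N\<^sub>2}"

text \<open>
  Convergence in probability to a constant, where the variables may live on a different
  probability space for each index. Measurability is part of the notion: \<^const>\<open>measure\<close> is 0 on
  non-measurable sets, so without it the limit condition could hold for no good reason.
\<close>
definition tendsto_in_prob ::
  "(nat \<Rightarrow> 'a measure) \<Rightarrow> (nat \<Rightarrow> 'a \<Rightarrow> 'b::metric_space) \<Rightarrow> 'b \<Rightarrow> bool" where
  "tendsto_in_prob M Z c \<longleftrightarrow>
     (\<forall>\<^sub>F n in sequentially. Z n \<in> borel_measurable (M n)) \<and>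
     (\<forall>e>0. (\<lambda>n. measure (M n) {\<omega> \<in> space (M n). dist (Z n \<omega>) c > e}) \<longlonglongrightarrow> 0)"

text \<open>
  Design matrices and response vectors are functions on the index sets \<open>{1..n} \<times> {1..p}\<close> and
  \<open>{1..n}\<close>; an estimator is a measurable function of the observed data \<open>(X, y)\<close>.
\<close>
definition is_estimator ::
  "'a measure \<Rightarrow> nat \<Rightarrow> nat \<Rightarrow> (nat \<times> nat \<Rightarrow> 'a \<Rightarrow> real) \<Rightarrow> (nat \<Rightarrow> 'a \<Rightarrow> real) \<Rightarrow> ('a \<Rightarrow> real) \<Rightarrow> bool"
where
  "is_estimator M n p X y G \<longleftrightarrow>
     (\<exists>g \<in> borel_measurable
             ((\<Pi>\<^sub>M a\<in>{1..n} \<times> {1..p}. borel) \<Otimes>\<^sub>M (\<Pi>\<^sub>M i\<in>{1..n}. borel)).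
        \<forall>\<omega> \<in> space M. G \<omega> = g (\<lambda>a\<in>{1..n} \<times> {1..p}. X a \<omega>, \<lambda>i\<in>{1..n}. y i \<omega>))"

definition pos_def :: "real ^ 'm ^ 'm \<Rightarrow> bool" where
  "pos_def A \<longleftrightarrow> transpose A = A \<and> (\<forall>v. v \<noteq> 0 \<longrightarrow> v \<bullet> (A *v v) > 0)"

text \<open>
  In the following two matrices, \<open>\<gamma>2 i j\<close> and \<open>\<eta>2 i j\<close> stand for \<open>\<gamma>\<^sub>i\<^sub>j\<close> and \<open>\<eta>\<^sub>i\<^sub>j\<close>. Each final
  \<open>else\<close> is the last case of the mathematical definition, since \<open>\<gamma> i \<noteq> \<eta> i\<close> is assumed throughout.
\<close>
definition risk_matrix ::
  "('m \<Rightarrow> real) \<Rightarrow> ('m \<Rightarrow> real) \<Rightarrow> ('m \<Rightarrow> 'm \<Rightarrow> real) \<Rightarrow> ('m \<Rightarrow> 'm \<Rightarrow> real) \<Rightarrow> real \<Rightarrow> real \<Rightarrow>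
   real ^ 'm ^ 'm"
where
  "risk_matrix \<gamma> \<eta> \<gamma>2 \<eta>2 r \<sigma> = (\<chi> i j.
     if i = j then
       (if \<gamma> i < \<eta> i then \<sigma>^2 * (\<gamma> i / (\<eta> i - \<gamma> i))
        else (1 - \<eta> i / \<gamma> i) * r^2 + \<eta> i / (\<gamma> i - \<eta> i) * \<sigma>^2)
     else if \<gamma> i < \<eta> i \<and> \<gamma> j < \<eta> j then
       (\<eta>2 i j * \<gamma>2 i j) / (\<eta> i * \<eta> j - \<eta>2 i j * \<gamma>2 i j) * \<sigma>^2
     else if \<gamma> i < \<eta> i \<and> \<eta> j < \<gamma> j then
       (\<eta>2 i j * \<gamma>2 i j) / (\<eta> i * \<gamma> j - \<eta>2 i j * \<gamma>2 i j) * \<sigma>^2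
     else if \<gamma> j < \<eta> j \<and> \<eta> i < \<gamma> i then
       (\<eta>2 i j * \<gamma>2 i j) / (\<eta> j * \<gamma> i - \<eta>2 i j * \<gamma>2 i j) * \<sigma>^2
     else
       ((\<gamma> i - \<eta> i) * (\<gamma> j - \<eta> j)) / (\<gamma> i * \<gamma> j - \<eta>2 i j * \<gamma>2 i j) * r^2
       + (\<eta>2 i j * \<gamma>2 i j) / (\<gamma> i * \<gamma> j - \<eta>2 i j * \<gamma>2 i j) * \<sigma>^2)"

definition risk_matrix_hat ::
  "('m \<Rightarrow> real) \<Rightarrow> ('m \<Rightarrow> real) \<Rightarrow> ('m \<Rightarrow> 'm \<Rightarrow> real) \<Rightarrow> ('m \<Rightarrow> 'm \<Rightarrow> real) \<Rightarrow> real \<Rightarrow>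
   real ^ 'm ^ 'm"
where
  "risk_matrix_hat \<gamma> \<eta> \<gamma>2 \<eta>2 G = (\<chi> i j.
     if i = j then
       (if \<gamma> i < \<eta> i then \<gamma> i / (\<eta> i - \<gamma> i)
        else (1 - \<eta> i / \<gamma> i) * G + \<eta> i / (\<gamma> i - \<eta> i))
     else if \<gamma> i < \<eta> i \<and> \<gamma> j < \<eta> j then
       (\<eta>2 i j * \<gamma>2 i j) / (\<eta> i * \<eta> j - \<eta>2 i j * \<gamma>2 i j)
     else if \<gamma> i < \<eta> i \<and> \<eta> j < \<gamma> j then
       (\<eta>2 i j * \<gamma>2 i j) / (\<eta> i * \<gamma> j - \<eta>2 i j * \<gamma>2 i j)
     else if \<gamma> j < \<eta> j \<and> \<eta> i < \<gamma> i then
       (\<eta>2 i j * \<gamma>2 i j) / (\<eta> j * \<gamma> i - \<eta>2 i j * \<gamma>2 i j)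
     else
       ((\<gamma> i - \<eta> i) * (\<gamma> j - \<eta> j)) / (\<gamma> i * \<gamma> j - \<eta>2 i j * \<gamma>2 i j) * G
       + (\<eta>2 i j * \<gamma>2 i j) / (\<gamma> i * \<gamma> j - \<eta>2 i j * \<gamma>2 i j))"

text \<open>
  The weights \<open>A\<^sup>-\<^sup>1 1 / (1\<^sup>T A\<^sup>-\<^sup>1 1)\<close>. An unspecified value results when \<open>A\<close> is singular, and 0 when the
  normalising constant vanishes.
\<close>
definition opt_weights :: "real ^ 'm ^ 'm \<Rightarrow> real ^ 'm" where
  "opt_weights A = (1 / (vec 1 \<bullet> (matrix_inv A *v vec 1))) *\<^sub>R (matrix_inv A *v vec 1)"

end

theory Submission
  imports Defs
begin

text \<open>
  At the true signal-to-noise ratio, the matrix \<open>risk_matrix_hat\<close> is the limiting risk matrix divided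
  by \<open>\<sigma>\<^sup>2\<close> (\<open>risk_matrix_eq_scaleR_hat\<close>). A positive factor changes neither the minimiser of a
  quadratic form nor positive definiteness, and the minimiser of a positive definite form on the
  hyperplane of vectors with coordinate sum 1 is \<open>opt_weights\<close>, by completing the square
  (\<open>opt_weights_unique_minimiser\<close>). Thus the target of the convergence is the value at
  \<open>r\<^sup>2 / \<sigma>\<^sup>2\<close> of the very function of \<open>\<Gamma>\<close> that defines the estimated weights.

  What remains is continuous mapping (\<open>tendsto_in_prob_compose\<close>): it takes continuity at the limit
  point alone, together with Borel measurability everywhere. Both come from Cramer's rule. Near a
  positive definite matrix the determinant and the normalising constant are nonzero, so that
  \<open>opt_weights\<close> is a quotient of polynomials in the entries. For an arbitrary value of \<open>\<Gamma>\<close> the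
  matrix may be singular, but there \<open>matrix_inv\<close> takes a single constant value, so that
  \<open>opt_weights\<close> is a measurable function on the whole space of matrices.
\<close>

lemma tendsto_in_prob_compose:
  fixes Z :: "nat \<Rightarrow> 'a \<Rightarrow> 'b::metric_space" and f :: "'b \<Rightarrow> 'c::metric_space"
  assumes prob: "\<And>n. n \<ge> 1 \<Longrightarrow> prob_space (M n)"
    and Z: "tendsto_in_prob M Z c"
    and f_meas: "f \<in> borel_measurable borel"
    and f_cont: "isCont f c"
  shows "tendsto_in_prob M (\<lambda>n \<omega>. f (Z n \<omega>)) (f c)"
  unfolding tendsto_in_prob_def
proof (intro conjI allI impI)
  have Z_meas: "\<forall>\<^sub>F n in sequentially. Z n \<in> borel_measurable (M n)"
    using Z unfolding tendsto_in_prob_def by blast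
  show "\<forall>\<^sub>F n in sequentially. (\<lambda>\<omega>. f (Z n \<omega>)) \<in> borel_measurable (M n)"
    using Z_meas by eventually_elim (rule measurable_compose[OF _ f_meas])
  fix e :: real assume "e > 0"
  then obtain d where "d > 0" and d: "\<And>x. dist x c < d \<Longrightarrow> dist (f x) (f c) < e"
    using f_cont unfolding continuous_at_eps_delta by metis
  \<comment> \<open>Continuity controls the open ball of radius \<open>d\<close>, whereas the hypothesis bounds the probability
    of a strict inequality; the radius \<open>d / 2\<close> leaves no gap between the two.\<close>
  let ?P = "\<lambda>n. measure (M n) {\<omega> \<in> space (M n). dist (Z n \<omega>) c > d / 2}"
  have P: "?P \<longlonglongrightarrow> 0"
    using Z half_gt_zero[OF \<open>d > 0\<close>] unfolding tendsto_in_prob_def by blast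
  have bound: "\<forall>\<^sub>F n in sequentially.
      measure (M n) {\<omega> \<in> space (M n). dist (f (Z n \<omega>)) (f c) > e} \<le> ?P n"
    using Z_meas eventually_ge_at_top[of 1]
  proof eventually_elim
    case (elim n)
    interpret prob_space "M n" using prob elim by simp
    have "open {x. d / 2 < dist x c}"
      by (intro open_Collect_less continuous_intros)
    then have "Z n -` {x. d / 2 < dist x c} \<inter> space (M n) \<in> sets (M n)"
      using elim by (intro measurable_sets[where A = borel]) auto
    also have "Z n -` {x. d / 2 < dist x c} \<inter> space (M n)
        = {\<omega> \<in> space (M n). dist (Z n \<omega>) c > d / 2}"
      by auto
    finally have "{\<omega> \<in> space (M n). dist (Z n \<omega>) c > d / 2} \<in> sets (M n)" .
    moreover have "dist x c > d / 2" if "dist (f x) (f c) > e" for x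
      using d[of x] that \<open>d > 0\<close> by (cases "dist x c < d") auto
    ultimately show ?case
      by (intro finite_measure_mono) auto
  qed
  show "(\<lambda>n. measure (M n) {\<omega> \<in> space (M n). dist (f (Z n \<omega>)) (f c) > e}) \<longlonglongrightarrow> 0"
    by (rule tendsto_sandwich[OF _ bound tendsto_const P]) simp
qed

lemma matrix_inv_solves:
  fixes A :: "real ^ 'm ^ 'm"
  assumes "det A \<noteq> 0"
  shows "A *v (matrix_inv A *v b) = b"
proof -
  have "\<exists>B. A ** B = mat 1 \<and> B ** A = mat 1"
    using assms invertible_det_nz[of A] unfolding invertible_def by blast
  then have "A ** matrix_inv A = mat 1"
    unfolding matrix_inv_def by (rule someI2_ex) blast
  then show ?thesis
    by (simp add: matrix_vector_mul_assoc)
qed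

text \<open>
  All singular matrices share one value of \<^const>\<open>matrix_inv\<close>, because the property that it
  chooses by is then the same unsatisfiable one. This is what makes the solution measurable across
  the set of singular matrices.
\<close>
lemma matrix_inv_singular:
  fixes A :: "real ^ 'm ^ 'm"
  assumes "det A = 0"
  shows "matrix_inv A = (SOME B. False)"
proof -
  have "\<not> (A ** B = mat 1 \<and> B ** A = mat 1)" for B
    using assms invertible_det_nz[of A] unfolding invertible_def by blast
  then show ?thesis
    unfolding matrix_inv_def by (simp only: simp_thms)
qed

lemma isCont_det:
  fixes A :: "'a::t2_space \<Rightarrow> real ^ 'm ^ 'm"
  assumes "isCont A x"
  shows "isCont (\<lambda>x. det (A x)) x"
  using assms unfolding det_def isCont_def by (intro tendsto_intros) auto

lemma open_det_nonzero: "open {A :: real ^ 'm ^ 'm. det A \<noteq> 0}"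
  by (intro open_Collect_neq continuous_on_const continuous_at_imp_continuous_on ballI
      isCont_det continuous_ident)

lemma isCont_matrix_inv_mult_vector:
  fixes A :: "real ^ 'm ^ 'm"
  assumes "det A \<noteq> 0"
  shows "isCont (\<lambda>A. matrix_inv A *v b) A"
proof -
  let ?replace = "\<lambda>k (A :: real ^ 'm ^ 'm). \<chi> i j. if j = k then b $ i else A $ i $ j"
  let ?cramer = "\<lambda>A. \<chi> k. det (?replace k A) / det A"
  have "isCont (?replace k) A" for k
    unfolding isCont_def
  proof (intro tendsto_vec_lambda)
    fix i j
    show "((\<lambda>A. if j = k then b $ i else A $ i $ j)
        \<longlongrightarrow> (if j = k then b $ i else A $ i $ j)) (at A)"
      by (cases "j = k") (auto intro!: tendsto_intros)
  qed
  then have "isCont (\<lambda>A. det (?replace k A) / det A) A" for k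
    using assms by (intro isCont_divide isCont_det continuous_ident) auto
  then have "isCont ?cramer A"
    unfolding isCont_def by (intro tendsto_vec_lambda)
  moreover have "\<forall>\<^sub>F B in nhds A. matrix_inv B *v b = ?cramer B"
  proof -
    have "\<forall>\<^sub>F B in nhds A. B \<in> {B. det B \<noteq> 0}"
      using assms by (intro eventually_nhds_in_open open_det_nonzero) simp
    then show ?thesis
    proof eventually_elim
      case (elim B)
      then have "det B \<noteq> 0" by simp
      from cramer[OF this] matrix_inv_solves[OF this] show ?case by blast
    qed
  qed
  ultimately show ?thesis
    using isCont_cong[THEN iffD2] by fast
qed

lemma borel_measurable_matrix_inv_mult_vector:
  "(\<lambda>A :: real ^ 'm ^ 'm. matrix_inv A *v b) \<in> borel_measurable borel"
proof -
  let ?U = "{A :: real ^ 'm ^ 'm. det A \<noteq> 0}"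
  have "?U \<in> sets borel"
    by (intro borel_open open_det_nonzero)
  then have "(\<lambda>A. if A \<in> ?U then matrix_inv A *v b else (SOME B. False) *v b)
      \<in> borel_measurable borel"
    by (rule borel_measurable_continuous_on_if)
      (auto intro!: continuous_at_imp_continuous_on isCont_matrix_inv_mult_vector)
  also have "(\<lambda>A. if A \<in> ?U then matrix_inv A *v b else (SOME B. False) *v b)
      = (\<lambda>A. matrix_inv A *v b)"
    by (auto simp: matrix_inv_singular)
  finally show ?thesis .
qed

lemma borel_measurable_opt_weights: "opt_weights \<in> borel_measurable borel"
  unfolding opt_weights_def[abs_def]
  using borel_measurable_matrix_inv_mult_vector by measurable

lemma det_nonzero_if_pos_def:
  assumes "pos_def A"
  shows "det A \<noteq> 0"
proof
  assume "det A = 0"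
  then have "\<not> (\<exists>B. B ** A = mat 1)"
    by (metis invertible_det_nz invertible_left_inverse)
  then obtain v where "v \<noteq> 0" "A *v v = 0"
    unfolding matrix_left_invertible_ker by blast
  with assms show False
    unfolding pos_def_def by (metis inner_zero_right less_irrefl)
qed

text \<open>
  With \<open>u = A\<^sup>-\<^sup>1 1\<close> the normalising constant \<open>1\<^sup>T u\<close> is the value \<open>u\<^sup>T A u\<close> of the
  quadratic form at a nonzero vector.
\<close>
lemma opt_weights_normaliser_pos:
  fixes A :: "real ^ 'm ^ 'm"
  assumes "pos_def A"
  shows "vec 1 \<bullet> (matrix_inv A *v vec 1) > 0"
proof -
  let ?u = "matrix_inv A *v vec 1"
  have Au: "A *v ?u = vec 1"
    using assms det_nonzero_if_pos_def matrix_inv_solves by blast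
  then have "?u \<noteq> 0"
    by (metis matrix_vector_mult_0_right vec_component zero_index zero_neq_one)
  then have "?u \<bullet> (A *v ?u) > 0"
    using assms unfolding pos_def_def by blast
  then show ?thesis
    by (simp only: Au inner_commute)
qed

lemma isCont_opt_weights:
  assumes "pos_def A"
  shows "isCont opt_weights A"
  using opt_weights_normaliser_pos[OF assms]
    isCont_matrix_inv_mult_vector[OF det_nonzero_if_pos_def[OF assms]]
  unfolding opt_weights_def[abs_def] by (intro continuous_intros) auto

lemma is_arg_min_unique:
  fixes f :: "'a \<Rightarrow> 'b::linorder"
  assumes "P x" and "\<And>y. P y \<Longrightarrow> y \<noteq> x \<Longrightarrow> f x < f y"
  shows "is_arg_min f P y \<longleftrightarrow> y = x"
  using assms unfolding is_arg_min_def by (metis less_asym)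

text \<open>
  At the point \<open>w\<^sub>0 = opt_weights A\<close> the gradient \<open>2 A w\<^sub>0\<close> is a multiple of the all-ones vector (the Lagrange
  condition), hence orthogonal to every direction \<open>d\<close> inside the constraint hyperplane. The cross
  term vanishes and moving by \<open>d\<close> raises the form by exactly \<open>d\<^sup>T A d\<close>.
\<close>
lemma opt_weights_unique_minimiser:
  fixes A :: "real ^ 'm ^ 'm"
  assumes "pos_def A"
  shows "is_arg_min (\<lambda>w. w \<bullet> (A *v w)) (\<lambda>w. (\<Sum>i\<in>UNIV. w $ i) = 1) w \<longleftrightarrow> w = opt_weights A"
proof (rule is_arg_min_unique)
  let ?u = "matrix_inv A *v vec 1"
  let ?s = "vec 1 \<bullet> ?u"
  let ?w = "opt_weights A"
  have s: "?s > 0"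
    by (rule opt_weights_normaliser_pos[OF assms])
  have sum_eq: "(\<Sum>i\<in>UNIV. v $ i) = vec 1 \<bullet> v" for v :: "real ^ 'm"
    by (simp add: inner_vec_def)
  show w_sum: "(\<Sum>i\<in>UNIV. ?w $ i) = 1"
    unfolding sum_eq using s by (simp add: opt_weights_def)
  have "A *v ?u = vec 1"
    using assms det_nonzero_if_pos_def matrix_inv_solves by blast
  then have Aw: "A *v ?w = (1 / ?s) *\<^sub>R vec 1"
    by (simp add: opt_weights_def matrix_vector_mult_scaleR)
  fix v :: "real ^ 'm"
  assume v_sum: "(\<Sum>i\<in>UNIV. v $ i) = 1" and "v \<noteq> ?w"
  define d where "d = v - ?w"
  have "vec 1 \<bullet> d = 0"
    using v_sum w_sum unfolding d_def sum_eq by (simp add: inner_diff_right)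
  then have dAw: "d \<bullet> (A *v ?w) = 0"
    by (simp add: Aw inner_commute)
  have "?w \<bullet> (A *v d) = (transpose A *v ?w) \<bullet> d"
    by (metis dot_lmul_matrix transpose_matrix_vector)
  also have "\<dots> = 0"
    using assms dAw unfolding pos_def_def by (simp add: inner_commute)
  finally have wAd: "?w \<bullet> (A *v d) = 0" .
  have "v = ?w + d"
    by (simp add: d_def)
  then have "v \<bullet> (A *v v) = ?w \<bullet> (A *v ?w) + d \<bullet> (A *v d)"
    using dAw wAd by (simp add: matrix_vector_right_distrib inner_add_left inner_add_right)
  moreover have "d \<bullet> (A *v d) > 0"
    using assms \<open>v \<noteq> ?w\<close> unfolding pos_def_def d_def by simp
  ultimately show "?w \<bullet> (A *v ?w) < v \<bullet> (A *v v)"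
    by simp
qed

lemma risk_matrix_eq_scaleR_hat:
  assumes "\<sigma> \<noteq> 0"
  shows "risk_matrix \<gamma> \<eta> \<gamma>2 \<eta>2 r \<sigma> = \<sigma>\<^sup>2 *\<^sub>R risk_matrix_hat \<gamma> \<eta> \<gamma>2 \<eta>2 (r\<^sup>2 / \<sigma>\<^sup>2)"
proof -
  have affine: "\<sigma>\<^sup>2 * (a * (r\<^sup>2 / \<sigma>\<^sup>2) + b) = a * r\<^sup>2 + b * \<sigma>\<^sup>2" for a b
    using assms by (simp add: distrib_left)
  have "risk_matrix \<gamma> \<eta> \<gamma>2 \<eta>2 r \<sigma> $ i $ j = \<sigma>\<^sup>2 * risk_matrix_hat \<gamma> \<eta> \<gamma>2 \<eta>2 (r\<^sup>2 / \<sigma>\<^sup>2) $ i $ j"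
    for i j
    unfolding risk_matrix_def risk_matrix_hat_def vec_lambda_beta if_distrib[of "(*) (\<sigma>\<^sup>2)"] affine
    by (simp only: mult.commute)
  then show ?thesis
    by (simp add: vec_eq_iff)
qed

text \<open>
  The variable \<open>G\<close> occurs in no denominator: each entry is an affine function of it, whatever its
  coefficients are (a quotient by zero being zero). The simplifier must not pull \<open>G\<close> into a
  numerator, where this would be lost.
\<close>
lemma isCont_risk_matrix_hat: "isCont (risk_matrix_hat \<gamma> \<eta> \<gamma>2 \<eta>2) G"
  unfolding isCont_def risk_matrix_hat_def[abs_def]
  by (intro tendsto_vec_lambda) 
    (auto intro!: tendsto_add tendsto_mult tendsto_const tendsto_ident_at
      simp del: times_divide_eq_left)

lemma pos_def_scaleR_iff:
  assumes "c > 0"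
  shows "pos_def (c *\<^sub>R A) \<longleftrightarrow> pos_def A"
proof -
  have "transpose (c *\<^sub>R A) = c *\<^sub>R A \<longleftrightarrow> transpose A = A"
    using assms by (simp add: transpose_scalar)
  then show ?thesis
    using assms
    by (simp add: pos_def_def scaleR_matrix_vector_assoc[symmetric] zero_less_mult_iff)
qed

lemma is_arg_min_scaleR_quadratic_form:
  fixes A :: "real ^ 'm ^ 'm"
  assumes "c > 0"
  shows "is_arg_min (\<lambda>w. w \<bullet> ((c *\<^sub>R A) *v w)) P = is_arg_min (\<lambda>w. w \<bullet> (A *v w)) P"
  using assms by (simp add: fun_eq_iff is_arg_min_def scaleR_matrix_vector_assoc[symmetric])

theorem corollary2p2:
  fixes M :: "nat \<Rightarrow> 'a measure"
    and p :: "nat \<Rightarrow> nat"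
    and X :: "nat \<Rightarrow> nat \<times> nat \<Rightarrow> 'a \<Rightarrow> real"
    and \<epsilon> y :: "nat \<Rightarrow> nat \<Rightarrow> 'a \<Rightarrow> real"
    and \<beta> :: "nat \<Rightarrow> nat \<Rightarrow> real"
    and S T :: "nat \<Rightarrow> 'm::finite \<Rightarrow> nat set"
    and \<gamma>0 \<xi> r \<sigma> :: real
    and \<gamma> \<eta> :: "'m \<Rightarrow> real"
    and \<gamma>2 \<eta>2 :: "'m \<Rightarrow> 'm \<Rightarrow> real"
    and \<Gamma> :: "nat \<Rightarrow> 'a \<Rightarrow> real"
  defines "H \<equiv> risk_matrix \<gamma> \<eta> \<gamma>2 \<eta>2 r \<sigma>"
  assumes prob: "\<And>n. n \<ge> 1 \<Longrightarrow> prob_space (M n)"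
    \<comment> \<open>linear model\<close>
    and y: "\<And>n i \<omega>. n \<ge> 1 \<Longrightarrow> i \<in> {1..n} \<Longrightarrow> \<omega> \<in> space (M n) \<Longrightarrow>
              y n i \<omega> = (\<Sum>k=1..p n. X n (i, k) \<omega> * \<beta> n k) + \<epsilon> n i \<omega>"
    and eps_iid: "\<And>n. n \<ge> 1 \<Longrightarrow> iid (M n) {1..n} (\<epsilon> n)"
    and eps_int: "\<And>n i. n \<ge> 1 \<Longrightarrow> i \<in> {1..n} \<Longrightarrow> integrable (M n) (\<lambda>\<omega>. (\<epsilon> n i \<omega>)\<^sup>2)"
    and eps_mean: "\<And>n i. n \<ge> 1 \<Longrightarrow> i \<in> {1..n} \<Longrightarrow> prob_space.expectation (M n) (\<epsilon> n i) = 0"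
    and eps_var: "\<And>n i. n \<ge> 1 \<Longrightarrow> i \<in> {1..n} \<Longrightarrow> prob_space.variance (M n) (\<epsilon> n i) = \<sigma>\<^sup>2"
    and sigma: "\<sigma>\<^sup>2 > 0"
    and eps_X_indep: "\<And>n. n \<ge> 1 \<Longrightarrow>
          indep_elements (M n)
            (\<Pi>\<^sub>M i\<in>{1..n}. borel) (\<lambda>\<omega>. \<lambda>i\<in>{1..n}. \<epsilon> n i \<omega>)
            (\<Pi>\<^sub>M a\<in>{1..n} \<times> {1..p n}. borel) (\<lambda>\<omega>. \<lambda>a\<in>{1..n} \<times> {1..p n}. X n a \<omega>)"
    \<comment> \<open>high-dimensional asymptotics, part 1: entries of the design matrix\<close>
    and X_iid: "\<And>n. n \<ge> 1 \<Longrightarrow> iid (M n) ({1..n} \<times> {1..p n}) (X n)"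
    and X_mean: "\<And>n a. n \<ge> 1 \<Longrightarrow> a \<in> {1..n} \<times> {1..p n} \<Longrightarrow> prob_space.expectation (M n) (X n a) = 0"
    and X_var: "\<And>n a. n \<ge> 1 \<Longrightarrow> a \<in> {1..n} \<times> {1..p n} \<Longrightarrow> prob_space.variance (M n) (X n a) = 1"
    and xi: "\<xi> > 0"
    and X_moment: "\<And>n a. n \<ge> 1 \<Longrightarrow> a \<in> {1..n} \<times> {1..p n} \<Longrightarrow>
          integrable (M n) (\<lambda>\<omega>. \<bar>X n a \<omega>\<bar> powr (12 + \<xi>))"
    \<comment> \<open>part 2: dimension\<close>
    and p_top: "filterlim p at_top sequentially"
    and p_ratio: "(\<lambda>n. real (p n) / real n) \<longlonglongrightarrow> \<gamma>0"
    and gamma0: "\<gamma>0 > 0"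
    \<comment> \<open>part 3: feature index sets\<close>
    and S_sub: "\<And>n i. n \<ge> 1 \<Longrightarrow> S n i \<subseteq> {1..p n}"
    and S_top: "\<And>i. filterlim (\<lambda>n. card (S n i)) at_top sequentially"
    and SS_top: "\<And>i j. filterlim (\<lambda>n. card (S n i \<inter> S n j)) at_top sequentially"
    and S_ratio: "\<And>i. (\<lambda>n. real (card (S n i)) / real n) \<longlonglongrightarrow> \<gamma> i"
    and SS_ratio: "\<And>i j. (\<lambda>n. real (card (S n i \<inter> S n j)) / real n) \<longlonglongrightarrow> \<gamma>2 i j"
    and gamma: "\<And>i. \<gamma> i > 0"
    and gamma2: "\<And>i j. \<gamma>2 i j > 0"
    \<comment> \<open>part 4: sample index sets\<close>
    and T_sub: "\<And>n i. n \<ge> 1 \<Longrightarrow> T n i \<subseteq> {1..n}"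
    and T_top: "\<And>i. filterlim (\<lambda>n. card (T n i)) at_top sequentially"
    and T_ratio: "\<And>i. (\<lambda>n. real (card (T n i)) / real n) \<longlonglongrightarrow> \<eta> i"
    and TT_ratio: "\<And>i j. (\<lambda>n. real (card (T n i \<inter> T n j)) / real n) \<longlonglongrightarrow> \<eta>2 i j"
    and eta: "\<And>i. \<eta> i > 0"
    and eta2: "\<And>i j. \<eta>2 i j > 0"
    and gamma_neq_eta: "\<And>i. \<gamma> i \<noteq> \<eta> i"
    \<comment> \<open>coefficients\<close>
    and r: "r > 0"
    and beta_norm: "\<And>n. n \<ge> 1 \<Longrightarrow> (\<Sum>k=1..p n. (\<beta> n k)\<^sup>2) = r\<^sup>2"
    and true_model: "\<And>n i k. n \<ge> 1 \<Longrightarrow> k \<in> {1..p n} \<Longrightarrow> k \<notin> S n i \<Longrightarrow> \<beta> n k = 0"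
    \<comment> \<open>the limiting risk matrix\<close>
    and H_pos_def: "pos_def H"
    \<comment> \<open>consistent estimator of the signal-to-noise ratio\<close>
    and Gamma_estimator: "\<And>n. n \<ge> 1 \<Longrightarrow> is_estimator (M n) n (p n) (X n) (y n) (\<Gamma> n)"
    and Gamma_consistent: "tendsto_in_prob M \<Gamma> (r\<^sup>2 / \<sigma>\<^sup>2)"
  shows "(\<exists>!w. is_arg_min (\<lambda>w. w \<bullet> (H *v w)) (\<lambda>w. (\<Sum>i\<in>UNIV. w $ i) = 1) w) \<and>
         tendsto_in_prob M
           (\<lambda>n \<omega>. opt_weights (risk_matrix_hat \<gamma> \<eta> \<gamma>2 \<eta>2 (\<Gamma> n \<omega>)))
           (arg_min (\<lambda>w. w \<bullet> (H *v w)) (\<lambda>w. (\<Sum>i\<in>UNIV. w $ i) = 1))"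
proof -
  let ?hat = "risk_matrix_hat \<gamma> \<eta> \<gamma>2 \<eta>2"
  let ?snr = "r\<^sup>2 / \<sigma>\<^sup>2"
  have H: "H = \<sigma>\<^sup>2 *\<^sub>R ?hat ?snr"
    using sigma unfolding H_def by (intro risk_matrix_eq_scaleR_hat) auto
  then have hat_pos: "pos_def (?hat ?snr)"
    using H_pos_def sigma by (simp add: pos_def_scaleR_iff)
  have min_iff: "is_arg_min (\<lambda>w. w \<bullet> (H *v w)) (\<lambda>w. (\<Sum>i\<in>UNIV. w $ i) = 1) w
      \<longleftrightarrow> w = opt_weights (?hat ?snr)" for w
    unfolding H is_arg_min_scaleR_quadratic_form[OF sigma]
    by (rule opt_weights_unique_minimiser[OF hat_pos])
  then have min_eq: "arg_min (\<lambda>w. w \<bullet> (H *v w)) (\<lambda>w. (\<Sum>i\<in>UNIV. w $ i) = 1)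
      = opt_weights (?hat ?snr)"
    by (simp add: arg_min_def)
  have "?hat \<in> borel_measurable borel"
    by (intro borel_measurable_continuous_onI continuous_at_imp_continuous_on ballI
        isCont_risk_matrix_hat)
  then have meas: "(\<lambda>G. opt_weights (?hat G)) \<in> borel_measurable borel"
    using borel_measurable_opt_weights by (rule measurable_compose)
  have cont: "isCont (\<lambda>G. opt_weights (?hat G)) ?snr"
    by (intro isCont_o2[OF isCont_risk_matrix_hat] isCont_opt_weights hat_pos)
  have "tendsto_in_prob M (\<lambda>n \<omega>. opt_weights (?hat (\<Gamma> n \<omega>))) (opt_weights (?hat ?snr))"
    by (rule tendsto_in_prob_compose[OF prob Gamma_consistent meas cont])
  then show ?thesis
    using min_iff min_eq by simp
qed

end
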